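(* Let $A=(A_{ij})\in M_n(\mathbb C)$ and suppose there is $0<c<+\infty$ for which $$|\operatorname{Im}A_{ij}\overline{A_{kl}}|<c\le\operatorname{Re}A_{ij}\overline{A_{kl}}\qquad\text{for all indices }i,j,k,l\in\{1,\dots,n\}.$$ Then $A$ has a spectral gap.
   Context: A complex square matrix has a spectral gap if it has an eigenvalue $\lambda$ that is simple (algebraic multiplicity one), whose modulus equals the spectral radius $r_{\rm sp}(A)$, and all other eigenvalues have modulus strictly smaller than $r_{\rm sp}(A)$. *)

theory Defs
  imports "Jordan_Normal_Form.Spectral_Radius"
begin

(* Meant for square matrices; the algebraic multiplicity of an eigenvalue is its order as a
   root of the characteristic polynomial. *)
definition has_spectral_gap :: "complex mat \<Rightarrow> bool" where
  "has_spectral_gap A \<longleftrightarrow>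
    (\<exists>ev. eigenvalue A ev \<and> order ev (char_poly A) = 1 \<and> cmod ev = spectral_radius A \<and>
          (\<forall>\<mu>. eigenvalue A \<mu> \<longrightarrow> \<mu> \<noteq> ev \<longrightarrow> cmod \<mu> < spectral_radius A))"

end

(* Let C be the complex cone of vectors x with Re (x_i * cnj x_j) >= 0 for all i, j. The bounds on A
   make A map C - {0} into the interior of C. This yields an eigenvector w in the interior: among
   the nonzero x in C, minimise the radius outside of which A x - z x stays in C; if A x were never
   a multiple of x, passing from x to A x would decrease that radius strictly.

   Every other eigenvalue mu is subdominant: take v with A v = mu v + beta w, independent of w.
   The set B of all z with v + z w outside the interior of C is compact and nonempty, and invariance
   of C forces the affine map z |-> (mu z - beta) / kappa to send B into its own interior, which is
   impossible for |mu| >= |kappa| because the image would have at least the diameter of B.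
   Allowing beta <> 0 lets a Schur basis starting at w cover Jordan blocks, hence multiplicity. *)
theory Submission
  imports Defs "HOL-Analysis.Topology_Euclidean_Space"
begin

section \<open>Expanding affine maps of the plane, and Bolzano-Weierstrass by coordinates\<close>

text \<open>Two points of \<open>B\<close> at maximal distance have images \<open>p\<close> and
  \<open>q\<close> at least as far apart. Since \<open>p\<close> is interior, it can be pushed a
  little further away from \<open>q\<close> inside \<open>B\<close>, which exceeds the
  diameter.\<close>

lemma compact_expanding_affine_escapes_interior:
  fixes B :: "complex set"
  assumes "compact B" "B \<noteq> {}" and s: "1 \<le> cmod s"
    and maps: "\<And>z. z \<in> B \<Longrightarrow> s * z + t \<in> interior B"
  shows False
proof -
  obtain a b where ab: "a \<in> B" "b \<in> B" and mx: "\<And>u v. u \<in> B \<Longrightarrow> v \<in> B \<Longrightarrow> dist u v \<le> dist a b"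
    using compact_sup_maxdistance[OF assms(1,2)] by blast
  define p q where "p = s * a + t" and "q = s * b + t"
  have pq: "p \<in> interior B" "q \<in> B"
    using maps[OF ab(1)] maps[OF ab(2)] interior_subset by (auto simp: p_def q_def)
  obtain e where e: "e > 0" "cball p e \<subseteq> B"
    using pq(1) by (auto simp: mem_interior_cball)
  \<comment> \<open>The direction from \<open>q\<close> to \<open>p\<close>. The default 1 keeps
    \<open>d\<close> a unit vector when \<open>p = q\<close>, where any direction will do.\<close>
  define d where "d = (if p = q then 1 else sgn (p - q))"
  have d: "cmod d = 1" by (simp add: d_def norm_sgn)
  have pq_d: "p - q = complex_of_real (cmod (p - q)) * d"
    by (simp add: d_def sgn_eq)
  define r where "r = p + complex_of_real e * d"
  have "r \<in> B" using e d by (auto simp: r_def dist_norm norm_mult)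
  moreover have "dist r q = cmod (p - q) + e"
  proof -
    have "r - q = (p - q) + complex_of_real e * d" by (simp add: r_def)
    also have "\<dots> = complex_of_real (cmod (p - q) + e) * d"
      by (subst pq_d) (simp add: algebra_simps)
    finally show ?thesis using d e by (simp only: dist_norm norm_mult norm_of_real) simp
  qed
  moreover have "cmod (p - q) = cmod s * dist a b"
    by (simp add: p_def q_def dist_norm flip: norm_mult right_diff_distrib)
  moreover have "cmod s * dist a b \<ge> dist a b"
    using mult_right_mono[OF s, of "dist a b"] by simp
  ultimately show False using mx[of r q] pq e(1) by force
qed

text \<open>Vectors are functions on all of \<open>nat\<close>, controlled only below
  \<open>n\<close>, so compactness is obtained by refining the subsequence one coordinate at a
  time.\<close>

lemma coordinatewise_convergent_subseq:
  fixes f :: "nat \<Rightarrow> nat \<Rightarrow> complex"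
  assumes "\<And>m i. i < n \<Longrightarrow> cmod (f m i) \<le> B"
  shows "\<exists>r l. strict_mono (r :: nat \<Rightarrow> nat) \<and> (\<forall>i<n. (\<lambda>m. f (r m) i) \<longlonglongrightarrow> l i)"
  using assms
proof (induction n)
  case 0
  show ?case by (intro exI[of _ id]) (auto simp: strict_mono_def)
next
  case (Suc n)
  then obtain r l where r: "strict_mono (r :: nat \<Rightarrow> nat)" and l: "\<forall>i<n. (\<lambda>m. f (r m) i) \<longlonglongrightarrow> l i"
    by (metis less_SucI)
  have "bounded (range (\<lambda>m. f (r m) n))"
    using Suc.prems[of n] by (auto simp: bounded_iff)
  then obtain l' r' where r': "strict_mono (r' :: nat \<Rightarrow> nat)" and l': "((\<lambda>m. f (r m) n) \<circ> r') \<longlonglongrightarrow> l'"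
    using bounded_imp_convergent_subsequence by blast
  have "(\<lambda>m. f (r (r' m)) i) \<longlonglongrightarrow> (if i = n then l' else l i)" if "i < Suc n" for i
  proof (cases "i = n")
    case True
    then show ?thesis using l' by (simp add: o_def)
  next
    case False
    then have "((\<lambda>m. f (r m) i) \<circ> r') \<longlonglongrightarrow> l i"
      using l that r' by (intro LIMSEQ_subseq_LIMSEQ) auto
    then show ?thesis using False by (simp add: o_def)
  qed
  moreover have "strict_mono (\<lambda>m. r (r' m))" using strict_mono_o[OF r r'] by (simp add: o_def)
  ultimately show ?case
    by (intro exI[of _ "\<lambda>m. r (r' m)"] exI[of _ "\<lambda>i. if i = n then l' else l i"]) simp
qed

section \<open>The complex cone and its interior\<close>

definition cone :: "nat \<Rightarrow> (nat \<Rightarrow> complex) \<Rightarrow> bool" where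
  "cone n x \<longleftrightarrow> (\<forall>i<n. \<forall>j<n. 0 \<le> Re (x i * cnj (x j)))"

text \<open>The diagonal case \<open>i = j\<close> forces every entry to be nonzero.\<close>

definition cone_int :: "nat \<Rightarrow> (nat \<Rightarrow> complex) \<Rightarrow> bool" where
  "cone_int n x \<longleftrightarrow> (\<forall>i<n. \<forall>j<n. 0 < Re (x i * cnj (x j)))"

lemma cone_int_imp_cone: "cone_int n x \<Longrightarrow> cone n x"
  by (auto simp: cone_def cone_int_def less_imp_le)

lemma cone_int_cong: "(\<And>i. i < n \<Longrightarrow> x i = y i) \<Longrightarrow> cone_int n x \<longleftrightarrow> cone_int n y"
  by (simp add: cone_int_def)

lemma cone_int_nonzero: "cone_int n x \<Longrightarrow> i < n \<Longrightarrow> x i \<noteq> 0"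
  by (force simp: cone_int_def)

lemma Re_scaled_mult_cnj: "Re ((c * x) * cnj (c * y)) = (cmod c)\<^sup>2 * Re (x * cnj y)"
proof -
  have "(c * x) * cnj (c * y) = complex_of_real ((cmod c)\<^sup>2) * (x * cnj y)"
    by (subst complex_norm_square) (simp add: mult_ac)
  then show ?thesis by (simp only: Re_complex_of_real times_complex.sel Im_complex_of_real)
qed

lemma cone_scale: "cone n x \<Longrightarrow> cone n (\<lambda>i. c * x i)"
  unfolding cone_def Re_scaled_mult_cnj by simp

lemma cone_int_scale_iff: "c \<noteq> 0 \<Longrightarrow> cone_int n (\<lambda>i. c * x i) \<longleftrightarrow> cone_int n x"
  unfolding cone_int_def Re_scaled_mult_cnj by (simp add: zero_less_mult_iff)

lemma cone_limit:
  assumes "\<And>i. i < n \<Longrightarrow> (\<lambda>m. f m i) \<longlonglongrightarrow> l i" and "\<forall>\<^sub>F m in sequentially. cone n (f m)"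
  shows "cone n l"
  unfolding cone_def
proof (intro allI impI)
  fix i j assume ij: "i < n" "j < n"
  have "(\<lambda>m. Re (f m i * cnj (f m j))) \<longlonglongrightarrow> Re (l i * cnj (l j))"
    using assms(1) ij by (intro tendsto_intros) auto
  moreover have "\<forall>\<^sub>F m in sequentially. 0 \<le> Re (f m i * cnj (f m j))"
    using assms(2) by eventually_elim (use ij in \<open>simp add: cone_def\<close>)
  ultimately show "0 \<le> Re (l i * cnj (l j))"
    by (rule tendsto_lowerbound) simp
qed

section \<open>Coefficients at which an affine line leaves the interior of the cone\<close>

text \<open>Negating \<open>cone_int\<close> rather than \<open>cone\<close> makes this set closed,
  and leaves room for the coefficients outside \<open>cone\<close> to lie in its interior.\<close>

definition bad_coeffs :: "nat \<Rightarrow> (nat \<Rightarrow> complex) \<Rightarrow> (nat \<Rightarrow> complex) \<Rightarrow> complex set" where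
  "bad_coeffs n u w = {z. \<not> cone_int n (\<lambda>i. u i + z * w i)}"

lemma open_not_cone: "open {z. \<not> cone n (\<lambda>i. u i + z * w i)}"
proof -
  have "{z. \<not> cone n (\<lambda>i. u i + z * w i)} =
    (\<Union>i\<in>{..<n}. \<Union>j\<in>{..<n}. {z. Re ((u i + z * w i) * cnj (u j + z * w j)) < 0})"
    by (auto simp: cone_def not_le)
  also have "open \<dots>"
    by (intro open_UN ballI open_Collect_less continuous_intros)
  finally show ?thesis .
qed

lemma closed_bad_coeffs: "closed (bad_coeffs n u w)"
proof -
  have "bad_coeffs n u w =
    (\<Union>i\<in>{..<n}. \<Union>j\<in>{..<n}. {z. Re ((u i + z * w i) * cnj (u j + z * w j)) \<le> 0})"
    by (auto simp: bad_coeffs_def cone_int_def not_less)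
  also have "closed \<dots>"
    by (intro closed_UN ballI closed_Collect_le continuous_intros) auto
  finally show ?thesis .
qed

lemma not_cone_subset_interior_bad_coeffs:
  "{z. \<not> cone n (\<lambda>i. u i + z * w i)} \<subseteq> interior (bad_coeffs n u w)"
  by (rule interior_maximal) (auto simp: bad_coeffs_def open_not_cone dest: cone_int_imp_cone)

text \<open>Up to the factor \<open>z\<close>, the vector \<open>u + z w\<close> is
  \<open>u / z + w\<close>. This tends to \<open>w\<close> as \<open>z\<close> grows, and the strict
  inequalities at \<open>w\<close> persist nearby.\<close>

lemma bounded_bad_coeffs:
  assumes w: "cone_int n w"
  shows "bounded (bad_coeffs n u w)"
proof -
  have "\<forall>\<^sub>F z in at_infinity. \<forall>i\<in>{..<n}. \<forall>j\<in>{..<n}. 0 < Re ((u i * inverse z + w i) * cnj (u j * inverse z + w j))"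
  proof (intro eventually_ball_finite ballI finite_lessThan)
    fix i j assume ij: "i \<in> {..<n}" "j \<in> {..<n}"
    have "((\<lambda>z. Re ((u i * inverse z + w i) * cnj (u j * inverse z + w j))) \<longlongrightarrow>
        Re ((u i * 0 + w i) * cnj (u j * 0 + w j))) at_infinity"
      by (intro tendsto_intros tendsto_inverse_0)
    then show "\<forall>\<^sub>F z in at_infinity. 0 < Re ((u i * inverse z + w i) * cnj (u j * inverse z + w j))"
      by (rule order_tendstoD) (use w ij in \<open>simp add: cone_int_def\<close>)
  qed
  then obtain R where R: "\<And>z. R \<le> cmod z \<Longrightarrow> cone_int n (\<lambda>i. u i * inverse z + w i)"
    unfolding eventually_at_infinity cone_int_def by (meson lessThan_iff)
  have "cmod z \<le> max R 0" if "z \<in> bad_coeffs n u w" for z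
  proof (rule ccontr)
    assume "\<not> cmod z \<le> max R 0"
    then have z: "z \<noteq> 0" and "cone_int n (\<lambda>i. u i * inverse z + w i)" using R by auto
    then have "cone_int n (\<lambda>i. z * (u i * inverse z + w i))" by (simp add: cone_int_scale_iff del: distrib_left)
    also have "(\<lambda>i. z * (u i * inverse z + w i)) = (\<lambda>i. u i + z * w i)"
      using z by (simp add: fun_eq_iff field_simps)
    finally show False using that by (simp add: bad_coeffs_def)
  qed
  then show ?thesis by (auto simp: bounded_iff)
qed

lemma compact_bad_coeffs: "cone_int n w \<Longrightarrow> compact (bad_coeffs n u w)"
  by (simp add: compact_eq_bounded_closed closed_bad_coeffs bounded_bad_coeffs)

text \<open>The chosen coefficient annihilates coordinate \<open>i\<close>, and no vector of
  \<open>cone_int\<close> has a zero coordinate.\<close>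

lemma bad_coeffs_nonempty:
  assumes "cone_int n w" "i < n"
  shows "- u i / w i \<in> bad_coeffs n u w"
proof -
  have "w i \<noteq> 0" using assms by (rule cone_int_nonzero)
  then have "u i + (- u i / w i) * w i = 0" by simp
  then show ?thesis
    using assms(2) cone_int_nonzero[of n "\<lambda>j. u j + (- u i / w i) * w j" i]
    unfolding bad_coeffs_def by blast
qed

section \<open>Spectral consequences of mapping the cone into its interior\<close>

definition mapply :: "nat \<Rightarrow> (nat \<Rightarrow> nat \<Rightarrow> complex) \<Rightarrow> (nat \<Rightarrow> complex) \<Rightarrow> nat \<Rightarrow> complex" where
  "mapply n a x i = (\<Sum>j<n. a i j * x j)"

lemma mapply_cong: "(\<And>j. j < n \<Longrightarrow> x j = y j) \<Longrightarrow> mapply n a x = mapply n a y"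
  by (simp add: mapply_def fun_eq_iff)

lemma mapply_scale: "mapply n a (\<lambda>j. c * x j) i = c * mapply n a x i"
  by (simp add: mapply_def sum_distrib_left mult_ac)

lemma mapply_add: "mapply n a (\<lambda>j. x j + y j) i = mapply n a x i + mapply n a y i"
  by (simp add: mapply_def distrib_left sum.distrib)

definition nonzero_vec :: "nat \<Rightarrow> (nat \<Rightarrow> complex) \<Rightarrow> bool" where
  "nonzero_vec n x \<longleftrightarrow> (\<exists>i<n. x i \<noteq> 0)"

text \<open>All information on eigenvalues is derived from this property; the bounds on the entries
  enter only in establishing it.\<close>

locale cone_contraction =
  fixes n :: nat and a :: "nat \<Rightarrow> nat \<Rightarrow> complex"
  assumes n_pos: "0 < n"
    and contracts: "\<And>x. cone n x \<Longrightarrow> nonzero_vec n x \<Longrightarrow> cone_int n (mapply n a x)"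
begin

text \<open>The hypothesis \<open>indep\<close> says that \<open>v\<close> is no multiple of
  \<open>w\<close>, so contraction applies to every \<open>v + z w\<close> in the cone. The case
  \<mu> = \<kappa>, \<beta> = 0 is allowed: its absurd conclusion shows that the eigenvectors for
  \<kappa> are multiples of \<open>w\<close>.\<close>

lemma subdominant:
  assumes w: "cone_int n w" and Aw: "\<And>i. i < n \<Longrightarrow> mapply n a w i = \<kappa> * w i"
    and Av: "\<And>i. i < n \<Longrightarrow> mapply n a v i = \<mu> * v i + \<beta> * w i"
    and indep: "\<And>z. nonzero_vec n (\<lambda>i. v i + z * w i)"
  shows "cmod \<mu> < cmod \<kappa>"
proof (rule ccontr)
  assume "\<not> cmod \<mu> < cmod \<kappa>"
  then have le: "cmod \<kappa> \<le> cmod \<mu>" by simp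
  have "nonzero_vec n w" using cone_int_nonzero[OF w n_pos] n_pos by (auto simp: nonzero_vec_def)
  then have "cone_int n (mapply n a w)" using contracts cone_int_imp_cone[OF w] by blast
  then have \<kappa>: "\<kappa> \<noteq> 0" using cone_int_nonzero[of n "mapply n a w" 0] Aw[OF n_pos] n_pos by auto
  then have \<mu>: "\<mu> \<noteq> 0" using le by auto
  let ?B = "bad_coeffs n v w"
  have "(\<mu> / \<kappa>) * z + (- \<beta> / \<kappa>) \<in> interior ?B" if z: "z \<in> ?B" for z
  proof -
    \<comment> \<open>Chosen so that \<open>A\<close> sends \<open>v + z' w\<close> to \<mu> times
      \<open>v + z w\<close>. If the latter is not interior, contraction puts
      \<open>v + z' w\<close> outside the cone.\<close>
    define z' where "z' = (\<mu> / \<kappa>) * z + (- \<beta> / \<kappa>)"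
    have \<kappa>z': "\<beta> + z' * \<kappa> = \<mu> * z" using \<kappa> by (simp add: z'_def field_simps)
    have "mapply n a (\<lambda>i. v i + z' * w i) i = \<mu> * (v i + z * w i)" if "i < n" for i
    proof -
      have "mapply n a (\<lambda>i. v i + z' * w i) i = \<mu> * v i + (\<beta> + z' * \<kappa>) * w i"
        using that by (simp add: mapply_add mapply_scale Aw Av algebra_simps)
      then show ?thesis unfolding \<kappa>z' by (simp add: algebra_simps)
    qed
    then have "cone_int n (mapply n a (\<lambda>i. v i + z' * w i)) \<longleftrightarrow> cone_int n (\<lambda>i. v i + z * w i)"
      using cone_int_scale_iff[OF \<mu>] by (simp cong: cone_int_cong)
    then have "\<not> cone n (\<lambda>i. v i + z' * w i)"
      using z contracts[OF _ indep] by (auto simp: bad_coeffs_def)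
    then show ?thesis
      using not_cone_subset_interior_bad_coeffs[of n v w] by (auto simp: z'_def)
  qed
  moreover have "1 \<le> cmod (\<mu> / \<kappa>)" using le \<kappa> by (simp add: norm_divide)
  ultimately show False
    using compact_expanding_affine_escapes_interior[OF compact_bad_coeffs[OF w]]
      bad_coeffs_nonempty[OF w n_pos] by blast
qed

section \<open>Existence of an eigenvector in the interior of the cone\<close>

text \<open>The sign in \<open>A x + z x\<close> matches \<open>bad_coeffs\<close>; only the modulus
  of \<open>z\<close> matters. Membership in the closed \<open>cone\<close> survives limits, so the
  infimum can be attained.\<close>

definition radii :: "real set" where
  "radii = {R. 0 \<le> R \<and> (\<exists>x. cone n x \<and> nonzero_vec n x \<and>
     (\<forall>z. R \<le> cmod z \<longrightarrow> cone n (\<lambda>i. mapply n a x i + z * x i)))}"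

lemma radii_nonempty: "radii \<noteq> {}"
proof -
  have one: "cone_int n (\<lambda>_. 1)" by (simp add: cone_int_def)
  then obtain R where R: "\<And>z. z \<in> bad_coeffs n (mapply n a (\<lambda>_. 1)) (\<lambda>_. 1) \<Longrightarrow> cmod z \<le> R"
    using bounded_bad_coeffs[OF one] unfolding bounded_iff by blast
  \<comment> \<open>The maximum with 0 makes the radius nonnegative, and adding 1 moves
    \<open>z\<close> strictly beyond the bound \<open>R\<close>.\<close>
  have "cone n (\<lambda>i. mapply n a (\<lambda>_. 1) i + z * 1)" if "max 0 R + 1 \<le> cmod z" for z
  proof -
    have "z \<notin> bad_coeffs n (mapply n a (\<lambda>_. 1)) (\<lambda>_. 1)" using R[of z] that by linarith
    then show ?thesis by (intro cone_int_imp_cone) (simp add: bad_coeffs_def)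
  qed
  then have "max 0 R + 1 \<in> radii"
    using cone_int_imp_cone[OF one] n_pos unfolding radii_def nonzero_vec_def by fastforce
  then show ?thesis by auto
qed

lemma Inf_radii_le: "R \<in> radii \<Longrightarrow> Inf radii \<le> R"
  by (rule cInf_lower) (auto simp: radii_def intro!: bdd_belowI[of _ 0])

text \<open>A minimising sequence is scaled to have moduli summing to 1. A subsequence converges in
  each coordinate, the normalisation keeps the limit nonzero, and the closed cone conditions pass to
  it.\<close>

lemma Inf_radii_attained:
  obtains x where "cone n x" "nonzero_vec n x"
    "\<And>z. Inf radii \<le> cmod z \<Longrightarrow> cone n (\<lambda>i. mapply n a x i + z * x i)"
proof -
  define \<rho> where "\<rho> = Inf radii"
  have "\<exists>x. cone n x \<and> (\<Sum>i<n. cmod (x i)) = 1 \<and>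
     (\<forall>z. \<rho> + inverse (real (Suc m)) \<le> cmod z \<longrightarrow> cone n (\<lambda>i. mapply n a x i + z * x i))" for m
  proof -
    have "Inf radii < \<rho> + inverse (real (Suc m))" by (simp add: \<rho>_def)
    then obtain R where R: "R \<in> radii" "R < \<rho> + inverse (real (Suc m))"
      using cInf_lessD[OF radii_nonempty] by blast
    then obtain x where x: "cone n x" "nonzero_vec n x"
      "\<And>z. R \<le> cmod z \<Longrightarrow> cone n (\<lambda>i. mapply n a x i + z * x i)"
      by (auto simp: radii_def)
    define s where "s = (\<Sum>i<n. cmod (x i))"
    have "s > 0" using x(2) unfolding s_def nonzero_vec_def
      by (auto intro!: sum_pos2)
    define y where "y = (\<lambda>i. complex_of_real (inverse s) * x i)"
    have "(\<Sum>i<n. cmod (y i)) = inverse s * s"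
      using \<open>s > 0\<close> by (simp only: y_def norm_mult norm_of_real s_def sum_distrib_left) simp
    then have "(\<Sum>i<n. cmod (y i)) = 1" using \<open>s > 0\<close> by simp
    moreover have "cone n y" unfolding y_def by (intro cone_scale x)
    moreover have "cone n (\<lambda>i. mapply n a y i + z * y i)"
      if "\<rho> + inverse (real (Suc m)) \<le> cmod z" for z
    proof -
      have "(\<lambda>i. mapply n a y i + z * y i) =
          (\<lambda>i. complex_of_real (inverse s) * (mapply n a x i + z * x i))"
        by (rule ext, simp only: y_def mapply_scale) (simp add: algebra_simps)
      then show ?thesis using x(3)[of z] R that by (simp add: cone_scale)
    qed
    ultimately show ?thesis by blast
  qed
  then obtain f where f: "\<And>m. cone n (f m)" "\<And>m. (\<Sum>i<n. cmod (f m i)) = 1"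
    "\<And>m z. \<rho> + inverse (real (Suc m)) \<le> cmod z \<Longrightarrow> cone n (\<lambda>i. mapply n a (f m) i + z * f m i)"
    by metis
  have "cmod (f m i) \<le> 1" if "i < n" for m i
    using member_le_sum[of i "{..<n}" "\<lambda>i. cmod (f m i)"] f(2)[of m] that by simp
  then obtain r l where r: "strict_mono (r :: nat \<Rightarrow> nat)" and l: "\<And>i. i < n \<Longrightarrow> (\<lambda>m. f (r m) i) \<longlonglongrightarrow> l i"
    using coordinatewise_convergent_subseq by blast
  have "cone n l" by (rule cone_limit[OF l]) (use f in auto)
  moreover have "nonzero_vec n l"
  proof -
    have "(\<lambda>m. \<Sum>i<n. cmod (f (r m) i)) \<longlonglongrightarrow> (\<Sum>i<n. cmod (l i))"
      using l by (intro tendsto_intros) auto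
    then have "(\<Sum>i<n. cmod (l i)) = 1" using f(2) by (simp add: LIMSEQ_const_iff)
    then show ?thesis by (auto simp: nonzero_vec_def intro: ccontr)
  qed
  moreover have "cone n (\<lambda>i. mapply n a l i + z * l i)" if "\<rho> \<le> cmod z" for z
  proof -
    \<comment> \<open>\<open>z\<close> is approached along its ray from outside, where the approximants \<open>f\<close> already lie in the cone.\<close>
    define d where "d = (if z = 0 then 1 else sgn z)"
    define h where "h = (\<lambda>m. inverse (real (Suc (r m))))"
    define y where "y = (\<lambda>m. z + complex_of_real (h m) * d)"
    have h0: "h \<longlonglongrightarrow> 0"
      using LIMSEQ_subseq_LIMSEQ[OF LIMSEQ_inverse_real_of_nat r] by (simp add: h_def o_def)
    have y: "y \<longlonglongrightarrow> z"
      unfolding y_def using h0 by (auto intro!: tendsto_eq_intros)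
    have "cmod (y m) = cmod z + h m" for m
    proof -
      have "z = complex_of_real (cmod z) * d" by (simp add: d_def sgn_eq)
      then have "y m = complex_of_real (cmod z + h m) * d"
        unfolding y_def by (metis distrib_right of_real_add)
      moreover have "cmod d = 1" by (simp add: d_def norm_sgn)
      moreover have "0 \<le> h m" by (simp add: h_def)
      ultimately show ?thesis by (simp only: norm_mult norm_of_real) simp
    qed
    then have "cone n (\<lambda>i. mapply n a (f (r m)) i + y m * f (r m) i)" for m
      using that by (intro f(3)) (simp add: h_def)
    then show ?thesis
      by (intro cone_limit[where f = "\<lambda>m i. mapply n a (f (r m)) i + y m * f (r m) i"])
        (use l y in \<open>auto simp: mapply_def intro!: tendsto_intros\<close>)
  qed
  ultimately show ?thesis using that unfolding \<rho>_def by blast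
qed

lemma eigenvector_in_cone:
  obtains w \<kappa> where "cone_int n w" "\<And>i. i < n \<Longrightarrow> mapply n a w i = \<kappa> * w i"
proof -
  obtain x where x: "cone n x" "nonzero_vec n x"
    and xz: "\<And>z. Inf radii \<le> cmod z \<Longrightarrow> cone n (\<lambda>i. mapply n a x i + z * x i)"
    using Inf_radii_attained by blast
  define y where "y = mapply n a x"
  have y: "cone_int n y" unfolding y_def by (rule contracts[OF x])
  have "\<exists>z. \<not> nonzero_vec n (\<lambda>i. y i + z * x i)"
  proof (rule ccontr)
    assume "\<nexists>z. \<not> nonzero_vec n (\<lambda>i. y i + z * x i)"
    then have nz: "nonzero_vec n (\<lambda>i. y i + z * x i)" for z by blast
    define B where "B = bad_coeffs n (mapply n a y) y"
    \<comment> \<open>By linearity \<open>A (y + z x) = A y + z y\<close>. For \<open>z\<close>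
      outside the optimal radius \<open>y + z x\<close> is a nonzero cone vector, so its image is
      interior and \<open>z\<close> is not bad for \<open>y\<close>.\<close>
    have small: "cmod z < Inf radii" if "z \<in> B" for z
    proof (rule ccontr)
      assume "\<not> cmod z < Inf radii"
      then have "cone_int n (mapply n a (\<lambda>i. y i + z * x i))"
        using contracts[OF _ nz] xz[of z] by (simp add: y_def)
      also have "mapply n a (\<lambda>i. y i + z * x i) = (\<lambda>i. mapply n a y i + z * y i)"
        by (simp add: fun_eq_iff mapply_add mapply_scale y_def)
      finally show False using that by (simp add: B_def bad_coeffs_def)
    qed
    \<comment> \<open>Compactness turns the pointwise strict bound into a gap: the largest modulus
      in \<open>B\<close> is below the infimum, and a radius halfway between the two is admissible
      for \<open>y\<close>.\<close>
    have "compact (cmod ` B)" "cmod ` B \<noteq> {}"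
      using compact_bad_coeffs[OF y] bad_coeffs_nonempty[OF y n_pos]
      by (auto simp: B_def intro!: compact_continuous_image continuous_intros)
    then obtain z0 where z0: "z0 \<in> B" and mx: "\<And>z. z \<in> B \<Longrightarrow> cmod z \<le> cmod z0"
      using compact_attains_sup[of "cmod ` B"] by auto
    define R where "R = (cmod z0 + Inf radii) / 2"
    have R: "cmod z0 < R" "R < Inf radii" using small[OF z0] by (auto simp: R_def)
    have "cone n (\<lambda>i. mapply n a y i + z * y i)" if "R \<le> cmod z" for z
      using mx[of z] R that by (intro cone_int_imp_cone) (auto simp: B_def bad_coeffs_def)
    moreover have "nonzero_vec n y" using cone_int_nonzero[OF y n_pos] n_pos by (auto simp: nonzero_vec_def)
    moreover have "0 \<le> R" using R(1) norm_ge_zero[of z0] by linarith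
    ultimately have "R \<in> radii"
      using cone_int_imp_cone[OF y] unfolding radii_def by blast
    then show False using Inf_radii_le[of R] R by simp
  qed
  \<comment> \<open>So \<open>y = A x\<close> is \<open>-z\<close> times \<open>x\<close>. As
    \<open>y\<close> has no zero entry, \<open>z\<close> is nonzero, and \<open>x\<close> itself is
    interior.\<close>
  then obtain z where z: "\<And>i. i < n \<Longrightarrow> y i = (- z) * x i"
    by (auto simp: nonzero_vec_def add_eq_0_iff2)
  then have "z \<noteq> 0" using cone_int_nonzero[OF y n_pos] n_pos by auto
  then have "cone_int n x"
    using y z cone_int_scale_iff[of "- z" n x] by (simp cong: cone_int_cong)
  then show ?thesis using that[of x "- z"] z by (simp add: y_def)
qed

end

section \<open>From the bounds on the entries to cone contraction\<close>

text \<open>Dividing a cone vector by such an \<open>s\<close> rotates all its entries into the closed first quadrant.\<close>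
lemma extremal_argument:
  assumes "finite S" "S \<noteq> {}" "\<And>p q. p \<in> S \<Longrightarrow> q \<in> S \<Longrightarrow> 0 \<le> Re (p * cnj q)" "0 \<notin> S"
  shows "\<exists>s\<in>S. \<forall>p\<in>S. 0 \<le> Im (p * cnj s)"
  using assms
proof (induction S rule: finite_ne_induct)
  case (singleton x)
  then show ?case by simp
next
  case (insert q S)
  then obtain s where s: "s \<in> S" "\<And>p. p \<in> S \<Longrightarrow> 0 \<le> Im (p * cnj s)" by auto
  show ?case
  proof (cases "0 \<le> Im (q * cnj s)")
    case True
    then show ?thesis using s by auto
  next
    case False
    have "0 \<le> Im (p * cnj q)" if p: "p \<in> S" for p
    proof -
      \<comment> \<open>Here \<open>q\<close> lies clockwise of \<open>s\<close> and becomes the new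
        extremal element. The identity expands the product of \<open>p * cnj s\<close> and the
        conjugate of \<open>q * cnj s\<close>; every factor on the right is nonnegative.\<close>
      have "(cmod s)\<^sup>2 * Im (p * cnj q) =
          Re (p * cnj s) * (- Im (q * cnj s)) + Im (p * cnj s) * Re (q * cnj s)"
        unfolding cmod_power2 by (simp add: algebra_simps power2_eq_square)
      also have "\<dots> \<ge> 0"
        using False s p insert.prems(1)[of p s] insert.prems(1)[of q s]
        by (intro add_nonneg_nonneg mult_nonneg_nonneg) auto
      finally show ?thesis using s(1) insert.prems(2) by (auto simp: zero_le_mult_iff)
    qed
    then show ?thesis by (intro bexI[of _ q]) auto
  qed
qed

text \<open>Single terms may be negative. After rotation by \<open>cnj s\<close> the entries are
  \<open>p j + i q j\<close> with \<open>p\<close> and \<open>q\<close> nonnegative, and each scaled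
  term is at least \<open>(p j - q j) * (p l - q l)\<close>. These products sum to a square.\<close>

lemma cone_sum_abs_Im_le_sum_Re:
  assumes x: "cone n x"
  shows "0 \<le> (\<Sum>j<n. \<Sum>l<n. Re (x j * cnj (x l)) - \<bar>Im (x j * cnj (x l))\<bar>)"
proof (cases "nonzero_vec n x")
  case False
  then show ?thesis by (simp add: nonzero_vec_def)
next
  case True
  define S where "S = x ` {..<n} - {0}"
  have "\<exists>s\<in>S. \<forall>p\<in>S. 0 \<le> Im (p * cnj s)"
    by (rule extremal_argument) (use x True in \<open>auto simp: S_def cone_def nonzero_vec_def\<close>)
  then obtain s where s: "s \<in> S" and sIm: "\<And>p. p \<in> S \<Longrightarrow> 0 \<le> Im (p * cnj s)" by blast
  define p q where "p = (\<lambda>j. Re (x j * cnj s))" and "q = (\<lambda>j. Im (x j * cnj s))"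
  have p: "0 \<le> p j" if "j < n" for j using x s that by (auto simp: S_def p_def cone_def)
  have q: "0 \<le> q j" if "j < n" for j
    using sIm[of "x j"] that by (cases "x j = 0") (auto simp: S_def q_def)
  have sc: "(cmod s)\<^sup>2 * Re (x j * cnj (x l)) = p j * p l + q j * q l"
    "(cmod s)\<^sup>2 * Im (x j * cnj (x l)) = q j * p l - p j * q l" for j l
    unfolding cmod_power2 p_def q_def by (simp_all add: algebra_simps power2_eq_square)
  have term_ge: "(p j * p l + q j * q l) - (q j * p l + p j * q l) \<le>
      (cmod s)\<^sup>2 * (Re (x j * cnj (x l)) - \<bar>Im (x j * cnj (x l))\<bar>)" if "j < n" "l < n" for j l
  proof -
    have "(cmod s)\<^sup>2 * \<bar>Im (x j * cnj (x l))\<bar> = \<bar>q j * p l - p j * q l\<bar>"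
      unfolding sc(2)[symmetric] by (simp add: abs_mult)
    also have "\<dots> \<le> q j * p l + p j * q l"
      using p q that by (intro abs_leI) (auto simp: algebra_simps)
    finally show ?thesis using sc(1)[of j l] by (simp add: right_diff_distrib)
  qed
  have "0 \<le> ((\<Sum>j<n. p j) - (\<Sum>j<n. q j))\<^sup>2" by simp
  also have "\<dots> = (\<Sum>j<n. \<Sum>l<n. (p j - q j) * (p l - q l))"
    by (simp only: sum_subtractf[symmetric] power2_eq_square sum_product)
  also have "\<dots> = (\<Sum>j<n. \<Sum>l<n. (p j * p l + q j * q l) - (q j * p l + p j * q l))"
    by (intro sum.cong refl) (simp add: algebra_simps)
  also have "\<dots> \<le> (\<Sum>j<n. \<Sum>l<n. (cmod s)\<^sup>2 * (Re (x j * cnj (x l)) - \<bar>Im (x j * cnj (x l))\<bar>))"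
    by (intro sum_mono term_ge) auto
  also have "\<dots> = (cmod s)\<^sup>2 * (\<Sum>j<n. \<Sum>l<n. Re (x j * cnj (x l)) - \<bar>Im (x j * cnj (x l))\<bar>)"
    by (simp only: sum_distrib_left)
  finally show ?thesis using s by (simp add: zero_le_mult_iff S_def)
qed

text \<open>The product of two output entries, one conjugated, is the sum of
  \<open>P j l * X j l\<close>. Its real part is bounded below termwise by \<open>c\<close> times
  the terms of \<open>cone_sum_abs_Im_le_sum_Re\<close>.\<close>

lemma cone_contraction_of_bounds:
  assumes n: "0 < n" and c: "0 < (c :: real)"
    and a: "\<And>i j k l. i < n \<Longrightarrow> j < n \<Longrightarrow> k < n \<Longrightarrow> l < n \<Longrightarrow>
           \<bar>Im (a i j * cnj (a k l))\<bar> < c \<and> c \<le> Re (a i j * cnj (a k l))"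
  shows "cone_contraction n a"
proof
  show "0 < n" by (rule n)
  fix x assume x: "cone n x" "nonzero_vec n x"
  show "cone_int n (mapply n a x)"
    unfolding cone_int_def
  proof (intro allI impI)
    fix i k assume ik: "i < n" "k < n"
    define X where "X = (\<lambda>j l. x j * cnj (x l))"
    define P where "P = (\<lambda>j l. a i j * cnj (a k l))"
    have term_eq: "Re (P j l * X j l) = Re (P j l) * Re (X j l) - Im (P j l) * Im (X j l)" for j l
      by simp
    have P: "\<bar>Im (P j l)\<bar> < c" "c \<le> Re (P j l)" and X: "0 \<le> Re (X j l)" if "j < n" "l < n" for j l
      using a ik that x(1) by (auto simp: P_def X_def cone_def)
    have le: "c * (Re (X j l) - \<bar>Im (X j l)\<bar>) \<le> Re (P j l * X j l)"
      and less: "Im (X j l) \<noteq> 0 \<Longrightarrow> c * (Re (X j l) - \<bar>Im (X j l)\<bar>) < Re (P j l * X j l)"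
      if jl: "j < n" "l < n" for j l
    proof -
      have 1: "c * Re (X j l) \<le> Re (P j l) * Re (X j l)"
        using P X jl by (intro mult_right_mono) auto
      have 2: "Im (P j l) * Im (X j l) \<le> \<bar>Im (P j l)\<bar> * \<bar>Im (X j l)\<bar>"
        by (metis abs_ge_self abs_mult)
      have 3: "\<bar>Im (P j l)\<bar> * \<bar>Im (X j l)\<bar> \<le> c * \<bar>Im (X j l)\<bar>"
        using P(1)[OF jl] by (intro mult_right_mono) auto
      have 4: "\<bar>Im (P j l)\<bar> * \<bar>Im (X j l)\<bar> < c * \<bar>Im (X j l)\<bar>" if "Im (X j l) \<noteq> 0"
        using P(1)[OF jl] that by (intro mult_strict_right_mono) auto
      show "c * (Re (X j l) - \<bar>Im (X j l)\<bar>) \<le> Re (P j l * X j l)"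
        using 1 2 3 by (simp only: term_eq right_diff_distrib)
      show "c * (Re (X j l) - \<bar>Im (X j l)\<bar>) < Re (P j l * X j l)" if "Im (X j l) \<noteq> 0"
        using 1 2 4[OF that] by (simp only: term_eq right_diff_distrib)
    qed
    have "mapply n a x i * cnj (mapply n a x k) = (\<Sum>j<n. \<Sum>l<n. P j l * X j l)"
      by (simp add: mapply_def sum_product P_def X_def mult_ac)
    then have eq: "Re (mapply n a x i * cnj (mapply n a x k)) = (\<Sum>j<n. \<Sum>l<n. Re (P j l * X j l))"
      by (simp only: Re_sum)
    let ?D = "\<Sum>j<n. \<Sum>l<n. c * (Re (X j l) - \<bar>Im (X j l)\<bar>)"
    have D: "?D = c * (\<Sum>j<n. \<Sum>l<n. Re (X j l) - \<bar>Im (X j l)\<bar>)"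
      by (simp only: sum_distrib_left)
    have D0: "0 \<le> ?D"
      unfolding D using cone_sum_abs_Im_le_sum_Re[OF x(1)] c by (simp add: X_def)
    have D_le: "?D \<le> (\<Sum>j<n. \<Sum>l<n. Re (P j l * X j l))"
      by (intro sum_mono le) auto
    \<comment> \<open>Two sources of strictness: a nonzero \<open>Im (X j l)\<close> makes one
      termwise estimate strict because \<open>Im (P j l)\<close> is strictly below \<open>c\<close>
      in modulus; otherwise all \<open>X j l\<close> are real and a diagonal term makes the lower
      bound itself positive.\<close>
    have "0 < (\<Sum>j<n. \<Sum>l<n. Re (P j l * X j l))"
    proof (cases "\<exists>j<n. \<exists>l<n. Im (X j l) \<noteq> 0")
      case True
      then obtain j l where jl: "j < n" "l < n" "Im (X j l) \<noteq> 0" by blast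
      have "?D < (\<Sum>j<n. \<Sum>l<n. Re (P j l * X j l))"
      proof (rule sum_strict_mono_ex1)
        have "(\<Sum>l<n. c * (Re (X j l) - \<bar>Im (X j l)\<bar>)) < (\<Sum>l<n. Re (P j l * X j l))"
        proof (rule sum_strict_mono_ex1)
          show "\<exists>l\<in>{..<n}. c * (Re (X j l) - \<bar>Im (X j l)\<bar>) < Re (P j l * X j l)"
            using less[OF jl] jl(2) by blast
        next
          show "\<forall>l\<in>{..<n}. c * (Re (X j l) - \<bar>Im (X j l)\<bar>) \<le> Re (P j l * X j l)"
            using le[OF jl(1)] by blast
        qed simp
        then show "\<exists>j\<in>{..<n}. (\<Sum>l<n. c * (Re (X j l) - \<bar>Im (X j l)\<bar>)) < (\<Sum>l<n. Re (P j l * X j l))"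
          using jl(1) by blast
        show "\<forall>j\<in>{..<n}. (\<Sum>l<n. c * (Re (X j l) - \<bar>Im (X j l)\<bar>)) \<le> (\<Sum>l<n. Re (P j l * X j l))"
          by (intro ballI sum_mono le) simp_all
      qed simp
      then show ?thesis using D0 by linarith
    next
      case False
      obtain j where j: "j < n" "x j \<noteq> 0" using x(2) by (auto simp: nonzero_vec_def)
      have "0 < (\<Sum>j<n. \<Sum>l<n. Re (X j l))"
      proof (rule sum_pos2[of _ j])
        show "0 < (\<Sum>l<n. Re (X j l))"
        proof (rule sum_pos2[of _ j])
          show "0 < Re (X j j)" using j(2) by (simp add: X_def sum_squares_gt_zero_iff complex_eq_iff)
        qed (use j X in auto)
      qed (use j X in \<open>auto intro!: sum_nonneg\<close>)
      moreover have "?D = c * (\<Sum>j<n. \<Sum>l<n. Re (X j l))"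
        unfolding D using False by simp
      ultimately have "0 < ?D" using c by simp
      then show ?thesis using D_le by linarith
    qed
    then show "0 < Re (mapply n a x i * cnj (mapply n a x k))" by (simp only: eq)
  qed
qed

section \<open>Schur bases and the roots of the characteristic polynomial\<close>

lemma mult_mat_vec_eq_mapply:
  assumes "A \<in> carrier_mat n n" "i < n" "v \<in> carrier_vec n"
  shows "(A *\<^sub>v v) $ i = mapply n (\<lambda>i j. A $$ (i, j)) (\<lambda>j. v $ j) i"
  using assms by (auto simp: mapply_def scalar_prod_def atLeast0LessThan intro!: sum.cong)

text \<open>The columns \<open>p k\<close> of a triangularising matrix, with \<open>t\<close> its strictly upper triangular part.\<close>
lemma schur_columns:
  fixes A :: "complex mat"
  assumes A: "A \<in> carrier_mat n n" and cp: "char_poly A = (\<Prod>e \<leftarrow> es. [:- e, 1:])"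
    and es: "length es = n"
  shows "\<exists>p t. (\<forall>k<n. \<forall>i<n.
      mapply n (\<lambda>i j. A $$ (i, j)) (p k) i = es ! k * p k i + (\<Sum>l<k. t l k * p l i)) \<and>
    (\<forall>c. (\<forall>i<n. (\<Sum>k<n. c k * p k i) = 0) \<longrightarrow> (\<forall>k<n. c k = 0))"
proof -
  obtain B P Q where schur: "schur_decomposition A es = (B, P, Q)"
    by (cases "schur_decomposition A es") auto
  from schur_decomposition[OF A cp schur] have sim: "similar_mat_wit A B P Q"
    and ut: "upper_triangular B" and diag: "diag_mat B = es" by auto
  from sim A have car: "B \<in> carrier_mat n n" "P \<in> carrier_mat n n" "Q \<in> carrier_mat n n"
    and PQ: "P * Q = 1\<^sub>m n" and QP: "Q * P = 1\<^sub>m n" and AB: "A = P * B * Q"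
    by (auto simp: similar_mat_wit_def Let_def)
  have "A * P = P * B * (Q * P)" unfolding AB using car by (simp add: assoc_mult_mat[of _ n n _ n _ n])
  then have AP: "A * P = P * B" using car QP by simp
  let ?p = "\<lambda>k i. P $$ (i, k)"
  have "mapply n (\<lambda>i j. A $$ (i, j)) (?p k) i = es ! k * ?p k i + (\<Sum>l<k. B $$ (l, k) * ?p l i)"
    if ki: "k < n" "i < n" for k i
  proof -
    have "mapply n (\<lambda>i j. A $$ (i, j)) (?p k) i = (A * P) $$ (i, k)"
      using A car ki by (simp add: mapply_def scalar_prod_def atLeast0LessThan)
    also have "\<dots> = (\<Sum>l<n. B $$ (l, k) * ?p l i)"
      unfolding AP using car ki by (simp add: scalar_prod_def atLeast0LessThan mult.commute)
    \<comment> \<open>Entries of \<open>B\<close> below the diagonal vanish, so column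
      \<open>k\<close> involves only the columns up to \<open>k\<close>.\<close>
    also have "\<dots> = (\<Sum>l<Suc k. B $$ (l, k) * ?p l i)"
      using ki car ut by (intro sum.mono_neutral_right) (auto simp: upper_triangular_def)
    also have "B $$ (k, k) = es ! k" using ki car unfolding diag[symmetric] by (simp add: diag_mat_def)
    ultimately show ?thesis by simp
  qed
  moreover have "\<forall>k<n. c k = 0" if c: "\<forall>i<n. (\<Sum>k<n. c k * ?p k i) = 0" for c
  proof -
    define v where "v = Matrix.vec n c"
    have "P *\<^sub>v v = 0\<^sub>v n"
      using car c by (intro eq_vecI) (auto simp: v_def scalar_prod_def atLeast0LessThan mult.commute)
    then have "Q *\<^sub>v (P *\<^sub>v v) = 0\<^sub>v n" using car by auto
    moreover have "Q *\<^sub>v (P *\<^sub>v v) = v"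
      using car QP assoc_mult_mat_vec[of Q n n P n v] by (simp add: v_def)
    ultimately have "v = 0\<^sub>v n" by simp
    then show ?thesis by (metis v_def index_vec index_zero_vec(1))
  qed
  ultimately show ?thesis
    by (intro exI[of _ ?p] exI[of _ "\<lambda>l k. B $$ (l, k)"] conjI allI impI) (assumption | simp)+
qed

lemma poly_linear_factors_eq_0_iff:
  fixes x :: "'a :: idom"
  shows "poly (\<Prod>e \<leftarrow> es. [:- e, 1:]) x = 0 \<longleftrightarrow> x \<in> set es"
  by (induction es) (auto simp: add_eq_0_iff)

text \<open>The list \<open>es\<close> holds the roots left after splitting off one copy of
  \<kappa>. Bounding all of them strictly also rules out a second copy, so the statement contains
  simplicity as well as dominance.\<close>

lemma char_poly_dominant_root:
  assumes A: "A \<in> carrier_mat n n" and contraction: "cone_contraction n (\<lambda>i j. A $$ (i, j))"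
  obtains \<kappa> es where "char_poly A = (\<Prod>e \<leftarrow> \<kappa> # es. [:- e, 1:])" "\<And>\<mu>. \<mu> \<in> set es \<Longrightarrow> cmod \<mu> < cmod \<kappa>"
proof -
  let ?a = "\<lambda>i j. A $$ (i, j)"
  interpret cone_contraction n ?a by (rule contraction)
  obtain w \<kappa> where w: "cone_int n w" and Aw: "\<And>i. i < n \<Longrightarrow> mapply n ?a w i = \<kappa> * w i"
    using eigenvector_in_cone by blast
  obtain es0 where cp: "char_poly A = (\<Prod>e \<leftarrow> es0. [:- e, 1:])" and len: "length es0 = n"
    using char_poly_factorized[OF A] by blast
  have "eigenvector A (Matrix.vec n w) \<kappa>"
    unfolding eigenvector_def
  proof (intro conjI)
    show "Matrix.vec n w \<noteq> 0\<^sub>v (dim_row A)"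
    proof
      assume "Matrix.vec n w = 0\<^sub>v (dim_row A)"
      then have "Matrix.vec n w $ 0 = 0\<^sub>v n $ 0" using A by simp
      then show False using cone_int_nonzero[OF w n_pos] n_pos by simp
    qed
    show "A *\<^sub>v Matrix.vec n w = \<kappa> \<cdot>\<^sub>v Matrix.vec n w"
    proof (rule eq_vecI)
      fix i assume "i < dim_vec (\<kappa> \<cdot>\<^sub>v Matrix.vec n w)"
      then have i: "i < n" by simp
      have "(A *\<^sub>v Matrix.vec n w) $ i = mapply n ?a (\<lambda>j. Matrix.vec n w $ j) i"
        by (rule mult_mat_vec_eq_mapply[OF A i]) simp
      also have "mapply n ?a (\<lambda>j. Matrix.vec n w $ j) = mapply n ?a w" by (rule mapply_cong) simp
      finally show "(A *\<^sub>v Matrix.vec n w) $ i = (\<kappa> \<cdot>\<^sub>v Matrix.vec n w) $ i" using Aw i by simp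
    qed (use A in auto)
  qed (use A in auto)
  then have "poly (char_poly A) \<kappa> = 0"
    using eigenvalue_root_char_poly[OF A] by (auto simp: eigenvalue_def)
  then have "\<kappa> \<in> set es0"
    unfolding cp by (simp add: poly_linear_factors_eq_0_iff)
  define es where "es = remove1 \<kappa> es0"
  have perm: "mset es0 = mset (\<kappa> # es)" using \<open>\<kappa> \<in> set es0\<close> by (simp add: es_def)
  have prod_mset: "(\<Prod>e \<leftarrow> xs. [:- e, 1:]) = (\<Prod>e \<leftarrow> ys. [:- e, 1:])" if "mset xs = mset ys" for xs ys :: "complex list"
    using that by (simp flip: prod_mset_prod_list)
  have "cmod \<mu> < cmod \<kappa>" if \<mu>: "\<mu> \<in> set es" for \<mu>
  proof -
    \<comment> \<open>The Schur basis may follow any order of the roots. With \<kappa> and \<mu> in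
      front, \<open>p 0\<close> is an eigenvector for \<kappa>, and \<open>A\<close> maps
      \<open>p 1\<close> to \<mu> times itself plus a multiple of \<open>p 0\<close>; \<mu> =
      \<kappa> is not excluded.\<close>
    define fs where "fs = \<kappa> # \<mu> # remove1 \<mu> es"
    have fs: "mset fs = mset es0" using perm \<mu> by (simp add: fs_def)
    then have "length fs = n" using len mset_eq_length by blast
    then have n2: "1 < n" by (auto simp: fs_def)
    have cp_fs: "char_poly A = (\<Prod>e \<leftarrow> fs. [:- e, 1:])"
      unfolding cp by (rule prod_mset[OF fs[symmetric]])
    obtain p t where Ap: "\<forall>k<n. \<forall>i<n. mapply n ?a (p k) i = fs ! k * p k i + (\<Sum>l<k. t l k * p l i)"
      and indep: "\<forall>c. (\<forall>i<n. (\<Sum>k<n. c k * p k i) = 0) \<longrightarrow> (\<forall>k<n. c k = 0)"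
      using schur_columns[OF A cp_fs \<open>length fs = n\<close>] by (elim exE conjE)
    have p0: "mapply n ?a (p 0) i = \<kappa> * p 0 i" if "i < n" for i
      using Ap[rule_format, OF n_pos that] by (simp add: fs_def)
    have p1: "mapply n ?a (p 1) i = \<mu> * p 1 i + t 0 1 * p 0 i" if "i < n" for i
      using Ap[rule_format, OF n2 that] by (simp add: fs_def)
    have indep2: "c0 = 0 \<and> c1 = 0" if "\<And>i. i < n \<Longrightarrow> c0 * p 0 i + c1 * p 1 i = 0" for c0 c1
    proof -
      define c where "c = (\<lambda>k::nat. if k = 0 then c0 else if k = 1 then c1 else 0)"
      have "(\<Sum>k<n. c k * p k i) = (\<Sum>k\<in>{0,1}. c k * p k i)" for i
        using n2 by (intro sum.mono_neutral_right) (auto simp: c_def)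
      then have "\<forall>i<n. (\<Sum>k<n. c k * p k i) = 0" using that by (simp add: c_def)
      then have "\<forall>k<n. c k = 0" using indep by blast
      then show ?thesis using n2 n_pos by (auto simp: c_def)
    qed
    \<comment> \<open>Independence of \<open>p 0\<close> and \<open>w\<close> would give
      \<open>cmod\<close> \<kappa> < \<open>cmod\<close> \<kappa> by \<open>subdominant\<close>, so
      \<open>p 0\<close> is a multiple of \<open>w\<close>.\<close>
    obtain z where "\<not> nonzero_vec n (\<lambda>i. p 0 i + z * w i)"
      using subdominant[OF w Aw, of "p 0" \<kappa> 0] p0 by auto
    then have p0w: "p 0 i = (- z) * w i" if "i < n" for i
      using that by (auto simp: nonzero_vec_def add_eq_0_iff2)
    have "z \<noteq> 0"
      using p0w indep2[of 1 0] by auto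
    show ?thesis
    proof (rule subdominant[OF w Aw, of "p 1" \<mu> "t 0 1 * (- z)"])
      show "mapply n ?a (p 1) i = \<mu> * p 1 i + t 0 1 * (- z) * w i" if "i < n" for i
        using p1[OF that] p0w[OF that] by simp
      show "nonzero_vec n (\<lambda>i. p 1 i + y * w i)" for y
      proof (rule ccontr)
        assume "\<not> nonzero_vec n (\<lambda>i. p 1 i + y * w i)"
        \<comment> \<open>Since \<open>w\<close> is \<open>p 0\<close> divided by \<open>-z\<close>,
          a vanishing \<open>p 1 + y w\<close> would be a linear relation between the first two
          Schur columns.\<close>
        then have "(- y / z) * p 0 i + 1 * p 1 i = 0" if "i < n" for i
          using that p0w[OF that] \<open>z \<noteq> 0\<close> by (simp add: nonzero_vec_def add.commute)
        then show False using indep2[of "- y / z" 1] by simp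
      qed
    qed
  qed
  moreover have "char_poly A = (\<Prod>e \<leftarrow> \<kappa> # es. [:- e, 1:])"
    unfolding cp by (rule prod_mset[OF perm])
  ultimately show ?thesis using that by blast
qed

theorem theorem7p1:
  fixes A :: "complex mat" and n :: nat and c :: real
  assumes "n \<ge> 1"
    and "A \<in> carrier_mat n n"
    and "c > 0"
    and "\<And>i j k l. i < n \<Longrightarrow> j < n \<Longrightarrow> k < n \<Longrightarrow> l < n \<Longrightarrow>
           \<bar>Im (A $$ (i, j) * cnj (A $$ (k, l)))\<bar> < c \<and> c \<le> Re (A $$ (i, j) * cnj (A $$ (k, l)))"
  shows "has_spectral_gap A"
proof -
  have n: "0 < n" using assms(1) by simp
  interpret cone_contraction n "\<lambda>i j. A $$ (i, j)"
    by (rule cone_contraction_of_bounds[OF n assms(3)]) (rule assms(4))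
  obtain \<kappa> es where cp: "char_poly A = (\<Prod>e \<leftarrow> \<kappa> # es. [:- e, 1:])"
    and small: "\<And>\<mu>. \<mu> \<in> set es \<Longrightarrow> cmod \<mu> < cmod \<kappa>"
    using char_poly_dominant_root[OF assms(2) cone_contraction_axioms] by blast
  have ev: "eigenvalue A \<mu> \<longleftrightarrow> \<mu> = \<kappa> \<or> \<mu> \<in> set es" for \<mu>
    unfolding eigenvalue_root_char_poly[OF assms(2)] cp
    by (simp add: poly_linear_factors_eq_0_iff del: prod_list.Cons list.map)
  have le: "cmod \<mu> \<le> cmod \<kappa>" if "eigenvalue A \<mu>" for \<mu>
    using that small by (force simp: ev)
  have rad: "spectral_radius A = cmod \<kappa>"
  proof (rule antisym)
    show "spectral_radius A \<le> cmod \<kappa>"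
      using spectral_radius_mem_max(1)[OF assms(2) n] le by (auto simp: spectrum_def)
    show "cmod \<kappa> \<le> spectral_radius A"
      using spectral_radius_mem_max(2)[OF assms(2) n] ev by (auto simp: spectrum_def)
  qed
  have "(\<Prod>e \<leftarrow> es. [:- e, 1:]) \<noteq> 0"
    by (auto simp: prod_list_zero_iff)
  moreover have "poly (\<Prod>e \<leftarrow> es. [:- e, 1:]) \<kappa> \<noteq> 0"
    using small[of \<kappa>] by (auto simp: poly_linear_factors_eq_0_iff)
  \<comment> \<open>The cofactor does not vanish at \<kappa>, so the order comes from the single
    factor split off.\<close>
  ultimately have "order \<kappa> (char_poly A) = 1"
    using order_power_n_n[of \<kappa> 1] unfolding cp
    by (simp add: order_mult order_0I del: mult_pCons_left)
  then show ?thesis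
    unfolding has_spectral_gap_def rad using ev small by blast
qed

end
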